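(* Suppose that $\mathcal{D} \subseteq \{d\in\mathbb{R}^n \mid Q+\mathrm{diag}(d)\succeq 0\}$, that $\mu_{\mathcal{D}}<\mu_{BW}$, and that $(\bar x,\bar v)\in\mathbb{R}^n\times\mathbb{R}$ is an optimal solution to the problem (DiagR) associated with $\mathcal{D}$. Then there exists a new vector $\hat d\in\mathbb{R}^n$ (that is, $\hat d\notin\mathcal{D}$) such that $Q+\mathrm{diag}(\hat d)\succeq 0$ and $$\bar v < \bar x^TQ\bar x + \sum_{i:\,\hat d_i<0}\hat d_i\,(\bar x_i^2-\ell_i(\bar x_i)) + \sum_{i:\,\hat d_i>0}\hat d_i\,(\bar x_i^2-u_i(\bar x_i)).$$
   Context: Let $Q$ be a real symmetric indefinite $n\times n$ matrix and $q \in \mathbb{R}^n$. For each $i\in\{1,\dots,n\}$ let $S_i \subseteq \mathbb{R}$ be a nonempty closed and bounded (not necessarily convex) set, and put $L_i := \min\{x \mid x\in S_i\}$, $R_i := \max\{x \mid x \in S_i\}$. Let $\ell_i : [L_i,R_i]\to\mathbb{R}$ be the largest convex function on $[L_i,R_i]$ such that $\ell_i(x)\le x^2$ for all $x\in S_i$, and let $u_i:[L_i,R_i]\to\mathbb{R}$ be the smallest concave function on $[L_i,R_i]$ such that $u_i(x)\ge x^2$ for all $x\in S_i$. For $d\in\mathbb{R}^n$, $\mathrm{diag}(d)$ is the diagonal matrix with diagonal $d$; $\succeq 0$ means positive semidefinite; $\langle A,B\rangle = \mathrm{trace}(A^T B)$. For a set $\mathcal{D}\subseteq\{d\in\mathbb{R}^n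 \mid Q+\mathrm{diag}(d)\succeq 0\}$, (DiagR) denotes the problem $$\min_{v\in\mathbb{R},\,x\in\mathbb{R}^n}\ v+q^Tx \quad \text{s.t.}\quad v \ge x^TQx + \sum_{i:\,d_i<0} d_i\,(x_i^2-\ell_i(x_i)) + \sum_{i:\,d_i>0} d_i\,(x_i^2-u_i(x_i))\ \ \forall d\in\mathcal{D},\qquad L_i\le x_i\le R_i,\ i=1,\dots,n,$$ and $\mu_{\mathcal{D}}$ denotes its optimal value (infimum, in the extended reals). $\mu_{BW}$ denotes the optimal value of the semidefinite relaxation $$\min_{x\in\mathbb{R}^n,\,X}\ \langle Q,X\rangle + q^Tx\quad\text{s.t.}\quad \ell_i(x_i)\le X_{ii}\le u_i(x_i),\ i=1,\dots,n,\qquad \begin{bmatrix}1 & x^T\\ x & X\end{bmatrix}\succeq 0,$$ where $X$ ranges over real symmetric $n\times n$ matrices, and the constraints $\ell_i(x_i)\le X_{ii}\le u_i(x_i)$ implicitly require $x_i\in[L_i,R_i]$. *)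

theory Defs
  imports "HOL-Analysis.Analysis"
begin

definition psd :: "real^'n^'n \<Rightarrow> bool" where
  "psd A \<longleftrightarrow> transpose A = A \<and> (\<forall>x. 0 \<le> x \<bullet> (A *v x))"

definition indefinite :: "real^'n^'n \<Rightarrow> bool" where
  "indefinite A \<longleftrightarrow> transpose A = A \<and> \<not> psd A \<and> \<not> psd (- A)"

definition diag :: "real^'n \<Rightarrow> real^'n^'n" where
  "diag d = (\<chi> i j. if i = j then d $ i else 0)"

definition mat_inner :: "real^'n^'n \<Rightarrow> real^'n^'n \<Rightarrow> real" where
  "mat_inner A B = trace (transpose A ** B)"

(* The matrix [1, x^T; x, X], of order n + 1: the extra first index is None. *)
definition bordered :: "real^'n \<Rightarrow> real^'n^'n \<Rightarrow> real^('n option)^('n option)" where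
  "bordered x X = (\<chi> i j. case (i, j) of
       (None, None) \<Rightarrow> 1
     | (None, Some k) \<Rightarrow> x $ k
     | (Some k, None) \<Rightarrow> x $ k
     | (Some k, Some m) \<Rightarrow> X $ k $ m)"

(* LEAST and GREATEST are the minimum and maximum of a set that attains them;
   lo_compact and hi_compact record that nonempty compact sets do. *)
definition lo :: "real set \<Rightarrow> real" where
  "lo S = (LEAST x. x \<in> S)"

definition hi :: "real set \<Rightarrow> real" where
  "hi S = (GREATEST x. x \<in> S)"

(* Only the values of l and u on {lo S..hi S} are constrained, and they are
   uniquely determined there. *)
definition largest_convex_below :: "real set \<Rightarrow> (real \<Rightarrow> real) \<Rightarrow> bool" where
  "largest_convex_below S l \<longleftrightarrow>
     convex_on {lo S..hi S} l \<and> (\<forall>x\<in>S. l x \<le> x\<^sup>2) \<and>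
     (\<forall>g. convex_on {lo S..hi S} g \<and> (\<forall>x\<in>S. g x \<le> x\<^sup>2) \<longrightarrow>
        (\<forall>x\<in>{lo S..hi S}. g x \<le> l x))"

definition smallest_concave_above :: "real set \<Rightarrow> (real \<Rightarrow> real) \<Rightarrow> bool" where
  "smallest_concave_above S u \<longleftrightarrow>
     concave_on {lo S..hi S} u \<and> (\<forall>x\<in>S. x\<^sup>2 \<le> u x) \<and>
     (\<forall>g. concave_on {lo S..hi S} g \<and> (\<forall>x\<in>S. x\<^sup>2 \<le> g x) \<longrightarrow>
        (\<forall>x\<in>{lo S..hi S}. u x \<le> g x))"

(* When Q + diag d is positive semidefinite this is a lower bound for <Q, X> over the
   X feasible together with x in the semidefinite relaxation, where X_ii - l_i(x_i) is
   weighted by -d_i if d_i < 0 and u_i(x_i) - X_ii by d_i if d_i > 0. *)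
definition diag_bound ::
  "real^'n^'n \<Rightarrow> ('n \<Rightarrow> real \<Rightarrow> real) \<Rightarrow> ('n \<Rightarrow> real \<Rightarrow> real) \<Rightarrow> real^'n \<Rightarrow> real^'n \<Rightarrow> real" where
  "diag_bound Q l u d x = x \<bullet> (Q *v x)
     + (\<Sum>i | d $ i < 0. d $ i * ((x $ i)\<^sup>2 - l i (x $ i)))
     + (\<Sum>i | d $ i > 0. d $ i * ((x $ i)\<^sup>2 - u i (x $ i)))"

definition DiagR_feasible ::
  "real^'n^'n \<Rightarrow> ('n \<Rightarrow> real set) \<Rightarrow> ('n \<Rightarrow> real \<Rightarrow> real) \<Rightarrow> ('n \<Rightarrow> real \<Rightarrow> real)
    \<Rightarrow> (real^'n) set \<Rightarrow> ((real^'n) \<times> real) set" where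
  "DiagR_feasible Q S l u D =
     {(x, v). (\<forall>d\<in>D. diag_bound Q l u d x \<le> v) \<and> (\<forall>i. lo (S i) \<le> x $ i \<and> x $ i \<le> hi (S i))}"

definition mu_DiagR ::
  "real^'n^'n \<Rightarrow> real^'n \<Rightarrow> ('n \<Rightarrow> real set) \<Rightarrow> ('n \<Rightarrow> real \<Rightarrow> real) \<Rightarrow> ('n \<Rightarrow> real \<Rightarrow> real)
    \<Rightarrow> (real^'n) set \<Rightarrow> ereal" where
  "mu_DiagR Q q S l u D = (INF (x, v)\<in>DiagR_feasible Q S l u D. ereal (v + q \<bullet> x))"

definition DiagR_optimal ::
  "real^'n^'n \<Rightarrow> real^'n \<Rightarrow> ('n \<Rightarrow> real set) \<Rightarrow> ('n \<Rightarrow> real \<Rightarrow> real) \<Rightarrow> ('n \<Rightarrow> real \<Rightarrow> real)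
    \<Rightarrow> (real^'n) set \<Rightarrow> real^'n \<Rightarrow> real \<Rightarrow> bool" where
  "DiagR_optimal Q q S l u D x v \<longleftrightarrow>
     (x, v) \<in> DiagR_feasible Q S l u D \<and>
     (\<forall>(y, w)\<in>DiagR_feasible Q S l u D. v + q \<bullet> x \<le> w + q \<bullet> y)"

definition BW_feasible ::
  "('n \<Rightarrow> real set) \<Rightarrow> ('n \<Rightarrow> real \<Rightarrow> real) \<Rightarrow> ('n \<Rightarrow> real \<Rightarrow> real) \<Rightarrow> ((real^'n) \<times> (real^'n^'n)) set" where
  "BW_feasible S l u =
     {(x, X). transpose X = X \<and>
        (\<forall>i. lo (S i) \<le> x $ i \<and> x $ i \<le> hi (S i)) \<and>
        (\<forall>i. l i (x $ i) \<le> X $ i $ i \<and> X $ i $ i \<le> u i (x $ i)) \<and>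
        psd (bordered x X)}"

definition mu_BW ::
  "real^'n^'n \<Rightarrow> real^'n \<Rightarrow> ('n \<Rightarrow> real set) \<Rightarrow> ('n \<Rightarrow> real \<Rightarrow> real) \<Rightarrow> ('n \<Rightarrow> real \<Rightarrow> real)
    \<Rightarrow> ereal" where
  "mu_BW Q q S l u = (INF (x, X)\<in>BW_feasible S l u. ereal (mat_inner Q X + q \<bullet> x))"

lemma lo_compact:
  assumes "compact S" "S \<noteq> {}"
  shows "lo S \<in> S" "x \<in> S \<Longrightarrow> lo S \<le> x"
proof -
  obtain s where s: "s \<in> S" "\<forall>t\<in>S. s \<le> t"
    using compact_attains_inf[OF assms] by blast
  then have "lo S = s"
    unfolding lo_def by (intro Least_equality) auto
  with s show "lo S \<in> S" "x \<in> S \<Longrightarrow> lo S \<le> x" by auto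
qed

lemma hi_compact:
  assumes "compact S" "S \<noteq> {}"
  shows "hi S \<in> S" "x \<in> S \<Longrightarrow> x \<le> hi S"
proof -
  obtain s where s: "s \<in> S" "\<forall>t\<in>S. t \<le> s"
    using compact_attains_sup[OF assms] by blast
  then have "hi S = s"
    unfolding hi_def by (intro Greatest_equality) auto
  with s show "hi S \<in> S" "x \<in> S \<Longrightarrow> x \<le> hi S" by auto
qed

lemma ex_largest_convex_minorant:
  fixes h :: "real \<Rightarrow> real"
  assumes S: "compact S" "S \<noteq> {}" and bdd: "\<And>x. x \<in> S \<Longrightarrow> c \<le> h x"
  obtains l where "convex_on {lo S..hi S} l" "\<And>x. x \<in> S \<Longrightarrow> l x \<le> h x"
    "\<And>g x. convex_on {lo S..hi S} g \<Longrightarrow> (\<And>x. x \<in> S \<Longrightarrow> g x \<le> h x) \<Longrightarrow>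
       x \<in> {lo S..hi S} \<Longrightarrow> g x \<le> l x"
proof -
  define I where "I = {lo S..hi S}"
  define G where "G = {g. convex_on I g \<and> (\<forall>x\<in>S. g x \<le> h x)}"
  define l where "l x = (SUP g\<in>G. g x)" for x
  have SI: "S \<subseteq> I"
    using lo_compact[OF S] hi_compact[OF S] by (auto simp: I_def)
  have I: "convex I" by (simp add: I_def)
  have "(\<lambda>_. c) \<in> G"
    using bdd I by (simp add: G_def convex_on_def flip: distrib_right)
  then have G: "G \<noteq> {}" by blast
  have bound: "g x \<le> max (h (lo S)) (h (hi S))" if "g \<in> G" "x \<in> I" for g x
  proof -
    have "g x \<le> max (g (lo S)) (g (hi S))"
      using that by (intro convex_on_le_max) (auto simp: G_def I_def)
    also have "\<dots> \<le> max (h (lo S)) (h (hi S))"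
      using that lo_compact(1)[OF S] hi_compact(1)[OF S]
      by (intro max.mono) (auto simp: G_def)
    finally show ?thesis .
  qed
  have upper: "g x \<le> l x" if "g \<in> G" "x \<in> I" for g x
    unfolding l_def
    by (rule cSUP_upper[OF that(1)]) (use bound[OF _ that(2)] in \<open>auto intro!: bdd_aboveI2\<close>)
  have "convex_on I l"
    unfolding convex_on_def
  proof (intro conjI I ballI allI impI)
    fix x y a b :: real
    assume *: "x \<in> I" "y \<in> I" "0 \<le> a" "0 \<le> b" "a + b = 1"
    have "g (a *\<^sub>R x + b *\<^sub>R y) \<le> a * l x + b * l y" if "g \<in> G" for g
    proof -
      have "g (a *\<^sub>R x + b *\<^sub>R y) \<le> a * g x + b * g y"
        using that * unfolding G_def convex_on_def by blast
      also have "\<dots> \<le> a * l x + b * l y"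
        using that * upper by (intro add_mono mult_left_mono) auto
      finally show ?thesis .
    qed
    then show "l (a *\<^sub>R x + b *\<^sub>R y) \<le> a * l x + b * l y"
      unfolding l_def[of "a *\<^sub>R x + b *\<^sub>R y"] using G by (intro cSUP_least)
  qed
  moreover have "l x \<le> h x" if "x \<in> S" for x
    unfolding l_def using G that by (intro cSUP_least) (auto simp: G_def)
  moreover have "g x \<le> l x" if "convex_on I g" "\<And>x. x \<in> S \<Longrightarrow> g x \<le> h x" "x \<in> I" for g x
    using that by (intro upper) (auto simp: G_def)
  ultimately show ?thesis
    by (intro that[of l]) (auto simp: I_def)
qed

lemma ex_largest_convex_below:
  assumes "compact S" "S \<noteq> {}"
  shows "\<exists>l. largest_convex_below S l"
  using ex_largest_convex_minorant[OF assms, of 0 "\<lambda>x. x\<^sup>2"]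
  unfolding largest_convex_below_def by (metis zero_le_power2)

lemma ex_smallest_concave_above:
  assumes "compact S" "S \<noteq> {}"
  shows "\<exists>u. smallest_concave_above S u"
proof -
  have "bdd_above ((\<lambda>x. x\<^sup>2) ` S)"
    using assms by (intro bounded_imp_bdd_above compact_imp_bounded compact_continuous_image
        continuous_intros)
  then obtain c where c: "\<And>x. x \<in> S \<Longrightarrow> x\<^sup>2 \<le> c"
    by (auto simp: bdd_above_def)
  obtain l where l: "convex_on {lo S..hi S} l" "\<And>x. x \<in> S \<Longrightarrow> l x \<le> - x\<^sup>2"
    "\<And>g x. convex_on {lo S..hi S} g \<Longrightarrow> (\<And>x. x \<in> S \<Longrightarrow> g x \<le> - x\<^sup>2) \<Longrightarrow>
       x \<in> {lo S..hi S} \<Longrightarrow> g x \<le> l x"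
    using ex_largest_convex_minorant[OF assms, of "- c" "\<lambda>x. - x\<^sup>2"] c by (metis neg_le_iff_le)
  have "smallest_concave_above S (\<lambda>x. - l x)"
    unfolding smallest_concave_above_def concave_on_def
  proof (intro conjI allI impI ballI)
    show "convex_on {lo S..hi S} (\<lambda>x. - (- l x))" using l(1) by simp
    show "x\<^sup>2 \<le> - l x" if "x \<in> S" for x using l(2)[OF that] by simp
    show "- l x \<le> g x"
      if "convex_on {lo S..hi S} (\<lambda>x. - g x) \<and> (\<forall>x\<in>S. x\<^sup>2 \<le> g x)" "x \<in> {lo S..hi S}" for g x
      using l(3)[of "\<lambda>x. - g x" x] that by auto
  qed
  then show ?thesis by blast
qed

end

theory Submission
  imports Defs
begin

text \<open>
  Fix \<open>x = xbar\<close>. The points of the semidefinite relaxation over \<open>x\<close> are the matrices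
  \<open>X = Y + x x\<^sup>T\<close> with \<open>Y\<close> positive semidefinite and \<open>a\<^sub>i \<le> Y\<^sub>i\<^sub>i \<le> b\<^sub>i\<close>, where
  \<open>a\<^sub>i = l\<^sub>i(x\<^sub>i) - x\<^sub>i\<^sup>2\<close> and \<open>b\<^sub>i = u\<^sub>i(x\<^sub>i) - x\<^sub>i\<^sup>2\<close>. Optimality of \<open>(xbar, vbar)\<close> gives
  \<open>vbar + q\<^sup>T x \<le> mu_DiagR < mu_BW\<close>, so no such \<open>Y\<close> satisfies \<open>\<langle>Q, Y\<rangle> \<le> vbar - x\<^sup>T Q x\<close>.
  The required \<open>dhat\<close> is a dual certificate of this infeasibility, and it lies outside \<open>D\<close>
  because \<open>(xbar, vbar)\<close> satisfies the constraint of every member of \<open>D\<close>.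

  The certificate comes from a theorem of alternatives (\<open>diagonal_sdp_alternative\<close>), proved by
  separating the box \<open>{v} \<times> [a, b]\<close> from the cone of all \<open>(t, diagonal of Y)\<close> with
  \<open>\<langle>Q, Y\<rangle> \<le> t\<close>. Strict separation needs a closed cone. It suffices to use the cone generated by
  the points \<open>(y\<^sup>T Q y, (y\<^sub>i\<^sup>2))\<close> with \<open>y\<close> of unit length together with \<open>(1, 0)\<close>: its points
  still come from positive semidefinite \<open>Y\<close>, and a normal \<open>(1, d)\<close> that is nonnegative on it has
  \<open>y\<^sup>T (Q + diag d) y \<ge> 0\<close> for all \<open>y\<close>. The generators form a compact set,
  and for large \<open>K\<close> the functional \<open>(t, z) \<mapsto> t + K (\<Sum>i. z\<^sub>i)\<close> is at least 1 on it,
  so that its convex hull misses the origin and generates a closed cone. The functional exists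
  because \<open>Q + K I\<close> is positive definite for large \<open>K\<close>, which is Slater's condition for the dual.
  The first coordinate of the separating normal cannot vanish, since \<open>a \<ge> 0\<close>; this holds
  because \<open>x\<^sup>2\<close> itself
  competes in the definition of \<open>l\<^sub>i\<close>. Scaled so that its first coordinate is 1, the normal is
  \<open>(1, dhat)\<close>.
\<close>

section \<open>Quadratic forms and positive semidefinite matrices\<close>

lemma mat_inner_alt: "mat_inner A B = (\<Sum>i\<in>UNIV. \<Sum>j\<in>UNIV. A $ i $ j * B $ i $ j)"
  unfolding mat_inner_def trace_def transpose_def matrix_matrix_mult_def
  by (simp, rule sum.swap)

lemma mat_inner_add: "mat_inner A (B + C) = mat_inner A B + mat_inner A C"
  by (simp add: mat_inner_alt distrib_left sum.distrib)

lemma mat_inner_scaleR: "mat_inner A (c *\<^sub>R B) = c * mat_inner A B"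
  by (simp add: mat_inner_alt sum_distrib_left mult.left_commute)

lemma psd_add: "psd A \<Longrightarrow> psd B \<Longrightarrow> psd (A + B)"
  unfolding psd_def
  by (simp add: transpose_def vec_eq_iff matrix_vector_mult_add_rdistrib inner_add_right)

lemma psd_scaleR: "psd A \<Longrightarrow> 0 \<le> c \<Longrightarrow> psd (c *\<^sub>R A)"
  unfolding psd_def
  by (simp add: transpose_def vec_eq_iff scaleR_matrix_vector_assoc[symmetric])

definition outer :: "real^'n \<Rightarrow> real^'n^'n" where
  "outer y = (\<chi> i j. y $ i * y $ j)"

lemma outer_mult_vec: "outer y *v w = (y \<bullet> w) *\<^sub>R y"
  by (simp add: outer_def vec_eq_iff matrix_vector_mult_def inner_vec_def sum_distrib_left
      algebra_simps)

lemma transpose_outer: "transpose (outer y) = outer y"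
  by (simp add: transpose_def outer_def vec_eq_iff mult.commute)

lemma outer_diagonal: "outer y $ i $ i = (y $ i)\<^sup>2"
  by (simp add: outer_def power2_eq_square)

lemma psd_outer: "psd (outer y)"
  by (simp add: psd_def transpose_outer outer_mult_vec inner_commute)

lemma quadratic_form_alt: "y \<bullet> (A *v y) = (\<Sum>i\<in>UNIV. \<Sum>j\<in>UNIV. A $ i $ j * (y $ i * y $ j))"
  by (simp add: inner_vec_def matrix_vector_mult_def sum_distrib_left algebra_simps)

lemma mat_inner_outer: "mat_inner A (outer y) = y \<bullet> (A *v y)"
  by (simp add: mat_inner_alt quadratic_form_alt outer_def)

lemma quadratic_form_diag: "y \<bullet> (diag d *v y) = (\<Sum>i\<in>UNIV. d $ i * (y $ i)\<^sup>2)"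
proof -
  have "(diag d *v y) $ i = d $ i * y $ i" for i
    by (simp add: diag_def matrix_vector_mult_def if_distrib[of "\<lambda>z. z * _"] cong: if_cong)
  then show ?thesis
    by (simp add: inner_vec_def power2_eq_square algebra_simps)
qed

text \<open>
  Completing the square: the quadratic form of the bordered matrix at \<open>(\<alpha>, w)\<close> is
  \<open>(\<alpha> + x\<^sup>T w)\<^sup>2 + w\<^sup>T Y w\<close>.
\<close>
lemma psd_bordered:
  fixes x :: "real^'n"
  assumes "psd Y"
  shows "psd (bordered x (Y + outer x))"
proof -
  have sum_option: "(\<Sum>i\<in>UNIV. f i) = f None + (\<Sum>i\<in>UNIV. f (Some i))"
    for f :: "'n option \<Rightarrow> real"
    by (simp add: UNIV_option_conv sum.reindex image_iff)
  have "transpose (Y + outer x) = Y + outer x"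
    using psd_add[OF assms psd_outer[of x]] by (simp add: psd_def)
  then have "transpose (bordered x (Y + outer x)) = bordered x (Y + outer x)"
    by (simp add: transpose_def bordered_def vec_eq_iff split: option.split)
  moreover have "0 \<le> z \<bullet> (bordered x (Y + outer x) *v z)" for z
  proof -
    define \<alpha> where "\<alpha> = z $ None"
    define w :: "real^'n" where "w = (\<chi> i. z $ Some i)"
    have none: "(bordered x (Y + outer x) *v z) $ None = \<alpha> + x \<bullet> w"
      by (simp add: matrix_vector_mult_def sum_option bordered_def \<alpha>_def w_def inner_vec_def)
    have some: "(bordered x (Y + outer x) *v z) $ Some i = \<alpha> * x $ i + ((Y + outer x) *v w) $ i"
      for i
      by (simp add: matrix_vector_mult_def sum_option bordered_def \<alpha>_def w_def mult.commute)
    have "z \<bullet> (bordered x (Y + outer x) *v z)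
        = \<alpha> * (\<alpha> + x \<bullet> w) + w \<bullet> (\<alpha> *\<^sub>R x + (Y + outer x) *v w)"
      by (simp add: inner_vec_def sum_option none[unfolded inner_vec_def] some \<alpha>_def w_def)
    also have "\<dots> = (\<alpha> + x \<bullet> w)\<^sup>2 + w \<bullet> (Y *v w)"
      by (simp add: inner_add_right matrix_vector_mult_add_rdistrib outer_mult_vec
          power2_eq_square algebra_simps inner_commute)
    also have "\<dots> \<ge> 0"
      using assms by (simp add: psd_def)
    finally show ?thesis .
  qed
  ultimately show ?thesis by (simp add: psd_def)
qed

section \<open>A theorem of alternatives for diagonal constraints\<close>

definition generator :: "real^'n^'n \<Rightarrow> real^'n \<Rightarrow> real \<times> (real^'n)" where
  "generator Q y = (y \<bullet> (Q *v y), \<chi> i. (y $ i)\<^sup>2)"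

text \<open>
  The additional generator \<open>(1, 0)\<close> makes the cone upward closed in its first coordinate, so that
  a separating normal has a nonnegative first coordinate.
\<close>
definition value_cone :: "real^'n^'n \<Rightarrow> (real \<times> (real^'n)) set" where
  "value_cone Q = conic hull (convex hull (insert (1, 0) (generator Q ` sphere 0 1)))"

lemma convex_value_cone: "convex (value_cone Q)"
  by (simp add: value_cone_def convex_conic_hull)

text \<open>
  The base is the convex hull of a compact set on which \<open>(t, z) \<mapsto> t + K (\<Sum>i. z\<^sub>i)\<close> is at least 1,
  hence is compact and misses the origin. On the unit sphere \<open>\<Sum>i. y\<^sub>i\<^sup>2 = 1\<close>, so any \<open>K\<close> with
  \<open>y\<^sup>T Q y + K \<ge> 1\<close> there will do.
\<close>
lemma closed_value_cone:
  fixes Q :: "real^'n^'n"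
  shows "closed (value_cone Q)"
proof -
  let ?G = "insert (1, 0) (generator Q ` sphere 0 1)"
  have cont: "continuous_on (sphere 0 1) (generator Q)"
    unfolding generator_def
    by (intro continuous_intros linear_continuous_on matrix_vector_mul_bounded_linear)
  have "compact (generator Q ` sphere 0 1)"
    by (intro compact_continuous_image cont) auto
  then have comp: "compact (convex hull ?G)"
    by (intro compact_convex_hull compact_insert)
  have "bounded ((\<lambda>y. y \<bullet> (Q *v y)) ` sphere 0 1)"
    by (intro compact_imp_bounded compact_continuous_image continuous_intros linear_continuous_on
        matrix_vector_mul_bounded_linear) auto
  then obtain B where B: "\<And>y. norm y = 1 \<Longrightarrow> \<bar>y \<bullet> (Q *v y)\<bar> \<le> B"
    by (fastforce simp: bounded_iff)
  define n :: "real \<times> (real^'n)" where "n = (1, \<chi> i. B + 1)"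
  have "1 \<le> n \<bullet> g" if "g \<in> ?G" for g
  proof -
    have "1 \<le> n \<bullet> generator Q y" if y: "norm y = 1" for y
    proof -
      have "(\<Sum>i\<in>UNIV. (y $ i)\<^sup>2) = 1"
        using y by (simp add: norm_eq_1 inner_vec_def power2_eq_square)
      then have "n \<bullet> generator Q y = y \<bullet> (Q *v y) + (B + 1)"
        by (simp add: n_def generator_def inner_vec_def sum_distrib_left[symmetric])
      with B[OF y] show ?thesis by simp
    qed
    with that show ?thesis by (auto simp: n_def)
  qed
  then have "convex hull ?G \<subseteq> {g. 1 \<le> n \<bullet> g}"
    by (intro hull_minimal) (auto simp: convex_halfspace_ge)
  then have "0 \<notin> convex hull ?G" by auto
  with comp show ?thesis
    unfolding value_cone_def by (intro closed_conic_hull) blast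
qed

text \<open>
  The generators have this property with \<open>Y = y y\<^sup>T\<close> and \<open>Y = 0\<close>, and the pairs that have it form
  a convex cone.
\<close>
lemma value_cone_psd:
  fixes Q :: "real^'n^'n"
  assumes "(t, z) \<in> value_cone Q"
  shows "\<exists>Y. psd Y \<and> mat_inner Q Y \<le> t \<and> (\<forall>i. Y $ i $ i = z $ i)"
proof -
  define W where "W = {(t, z). \<exists>Y. psd Y \<and> mat_inner Q Y \<le> t \<and> (\<forall>i. Y $ i $ i = z $ i)}"
  have add: "p + p' \<in> W" if W: "p \<in> W" "p' \<in> W" for p p'
  proof -
    obtain t z where p: "p = (t, z)" by (cases p)
    obtain t' z' where p': "p' = (t', z')" by (cases p')
    obtain Y where Y: "psd Y" "mat_inner Q Y \<le> t" "\<forall>i. Y $ i $ i = z $ i"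
      using W(1) by (auto simp: W_def p)
    obtain Y' where Y': "psd Y'" "mat_inner Q Y' \<le> t'" "\<forall>i. Y' $ i $ i = z' $ i"
      using W(2) by (auto simp: W_def p')
    show ?thesis
      using p p' Y Y' by (auto simp: W_def mat_inner_add intro!: exI[of _ "Y + Y'"] psd_add)
  qed
  have scale: "c *\<^sub>R p \<in> W" if W: "p \<in> W" and c: "0 \<le> c" for p c
  proof -
    obtain t z Y where p: "p = (t, z)"
      and Y: "psd Y" "mat_inner Q Y \<le> t" "\<forall>i. Y $ i $ i = z $ i"
      using W by (auto simp: W_def)
    show ?thesis
      using p Y c
      by (auto simp: W_def mat_inner_scaleR intro!: exI[of _ "c *\<^sub>R Y"] psd_scaleR mult_left_mono)
  qed
  have "psd (0 :: real^'n^'n)"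
    by (simp add: psd_def transpose_def vec_eq_iff)
  then have "(1, 0) \<in> W"
    by (auto simp: W_def mat_inner_alt intro!: exI[of _ 0])
  moreover have "generator Q y \<in> W" for y
  proof -
    have "psd (outer y) \<and> mat_inner Q (outer y) \<le> y \<bullet> (Q *v y)
        \<and> (\<forall>i. outer y $ i $ i = (\<chi> i. (y $ i)\<^sup>2) $ i)"
      by (simp only: psd_outer mat_inner_outer outer_diagonal) simp
    then show ?thesis
      unfolding W_def generator_def by blast
  qed
  moreover have "convex W"
    unfolding convex_def using add scale by blast
  moreover have "conic W"
    unfolding conic_def using scale by blast
  ultimately have "value_cone Q \<subseteq> W"
    unfolding value_cone_def by (intro hull_minimal) auto
  with assms show ?thesis by (auto simp: W_def)
qed

text \<open>
  This is the strong half of semidefinite duality. The weak half is that any such \<open>d\<close> proves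
  infeasibility: \<open>\<langle>Q + diag d, Y\<rangle> \<ge> 0\<close> gives \<open>\<langle>Q, Y\<rangle> \<ge> - (\<Sum>i. d\<^sub>i Y\<^sub>i\<^sub>i)\<close>, and over the box the
  right-hand side is smallest at \<open>Y\<^sub>i\<^sub>i = a\<^sub>i\<close> where \<open>d\<^sub>i < 0\<close> and \<open>Y\<^sub>i\<^sub>i = b\<^sub>i\<close> where \<open>d\<^sub>i > 0\<close>.
\<close>
lemma diagonal_sdp_alternative:
  fixes Q :: "real^'n^'n" and a b :: "real^'n"
  assumes sym: "transpose Q = Q" and a: "\<And>i. 0 \<le> a $ i" and ab: "\<And>i. a $ i \<le> b $ i"
    and infeasible: "\<And>Y. psd Y \<Longrightarrow> (\<And>i. a $ i \<le> Y $ i $ i) \<Longrightarrow> (\<And>i. Y $ i $ i \<le> b $ i) \<Longrightarrow>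
      v < mat_inner Q Y"
  obtains d where "psd (Q + diag d)"
    "v + (\<Sum>i | d $ i < 0. d $ i * a $ i) + (\<Sum>i | d $ i > 0. d $ i * b $ i) < 0"
proof -
  have box: "cbox (v, a) (v, b) = {v} \<times> cbox a b"
    by (simp add: cbox_Pair_eq)
  have "value_cone Q \<inter> cbox (v, a) (v, b) = {}"
    using value_cone_psd[of v _ Q] infeasible
    by (force simp: box mem_box_cart)
  moreover have "cbox (v, a) (v, b) \<noteq> {}"
    using ab by (auto simp: box interval_eq_empty_cart not_less)
  ultimately obtain n \<beta> where cone: "\<And>p. p \<in> value_cone Q \<Longrightarrow> \<beta> < n \<bullet> p"
    and below: "\<And>p. p \<in> cbox (v, a) (v, b) \<Longrightarrow> n \<bullet> p < \<beta>"
    using separating_hyperplane_compact_closed[of "cbox (v, a) (v, b)" "value_cone Q"]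
      convex_value_cone closed_value_cone
    by (metis convex_box(1) compact_cbox inf_commute)
  obtain \<tau> d where n: "n = (\<tau>, d)" by (cases n)
  have inner_n: "n \<bullet> (t, z) = \<tau> * t + d \<bullet> z" for t z
    by (simp add: n)
  have "0 \<in> value_cone Q"
    unfolding value_cone_def by (simp add: conic_hull_contains_0)
  from cone[OF this] have "\<beta> < 0" by simp
  have nonneg: "0 \<le> n \<bullet> p" if p: "p \<in> value_cone Q" for p
  proof (rule ccontr)
    assume neg: "\<not> 0 \<le> n \<bullet> p"
    then have "(\<beta> / (n \<bullet> p)) *\<^sub>R p \<in> value_cone Q"
      using \<open>\<beta> < 0\<close> p unfolding value_cone_def
      by (intro conicD[OF conic_conic_hull]) (auto simp: divide_nonpos_neg)
    from cone[OF this] neg show False by simp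
  qed
  have base: "p \<in> value_cone Q" if "p \<in> insert (1, 0) (generator Q ` sphere 0 1)" for p
    unfolding value_cone_def by (intro hull_inc that)
  have "0 \<le> \<tau>"
    using nonneg[OF base, of "(1, 0)"] by (simp add: inner_n)
  have generator_nonneg: "0 \<le> \<tau> * (y \<bullet> (Q *v y)) + (\<Sum>i\<in>UNIV. d $ i * (y $ i)\<^sup>2)"
    if "norm y = 1" for y
    using nonneg[OF base, of "generator Q y"] that
    by (simp add: generator_def inner_n inner_vec_def)
  \<comment> \<open>With \<open>\<tau> = 0\<close> the normal would have \<open>d \<ge> 0\<close>, hence be nonnegative at \<open>(v, a)\<close> since \<open>a \<ge> 0\<close>.\<close>
  have "\<tau> \<noteq> 0"
  proof
    assume "\<tau> = 0"
    have "0 \<le> d $ i" for i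
    proof -
      have "(\<Sum>j\<in>UNIV. d $ j * (axis i (1::real) $ j)\<^sup>2) = d $ i"
        by (simp add: axis_def if_distrib[of "\<lambda>z. _ * z\<^sup>2"] cong: if_cong)
      then show ?thesis
        using generator_nonneg[of "axis i 1"] \<open>\<tau> = 0\<close> by simp
    qed
    then have "0 \<le> n \<bullet> (v, a)"
      using a \<open>\<tau> = 0\<close> by (simp add: inner_n inner_vec_def sum_nonneg)
    moreover have "(v, a) \<in> cbox (v, a) (v, b)"
      using ab by (simp add: box mem_box_cart)
    ultimately show False
      using below[of "(v, a)"] \<open>\<beta> < 0\<close> by simp
  qed
  with \<open>0 \<le> \<tau>\<close> have "0 < \<tau>" by simp
  define e where "e = (1 / \<tau>) *\<^sub>R d"
  have d_eq: "d = \<tau> *\<^sub>R e"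
    using \<open>0 < \<tau>\<close> by (simp add: e_def)
  have unit: "0 \<le> y \<bullet> ((Q + diag e) *v y)" if "norm y = 1" for y
  proof -
    have "\<tau> * (y \<bullet> ((Q + diag e) *v y)) = \<tau> * (y \<bullet> (Q *v y)) + (\<Sum>i\<in>UNIV. d $ i * (y $ i)\<^sup>2)"
      by (simp add: d_eq matrix_vector_mult_add_rdistrib inner_add_right quadratic_form_diag
          distrib_left sum_distrib_left mult.assoc)
    with generator_nonneg[OF that] have "0 \<le> \<tau> * (y \<bullet> ((Q + diag e) *v y))"
      by simp
    with \<open>0 < \<tau>\<close> show ?thesis
      by (simp only: zero_le_mult_iff) auto
  qed
  have "0 \<le> w \<bullet> ((Q + diag e) *v w)" for w
  proof (cases "w = 0")
    case False
    define y where "y = sgn w"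
    have "w = norm w *\<^sub>R y"
      by (simp add: y_def sgn_div_norm False)
    moreover have "c *\<^sub>R y \<bullet> ((Q + diag e) *v (c *\<^sub>R y)) = c\<^sup>2 * (y \<bullet> ((Q + diag e) *v y))" for c
      by (simp add: matrix_vector_mult_scaleR power2_eq_square)
    ultimately have "w \<bullet> ((Q + diag e) *v w) = (norm w)\<^sup>2 * (y \<bullet> ((Q + diag e) *v y))"
      by metis
    with unit[of y] False show ?thesis by (simp add: y_def norm_sgn)
  qed simp
  then have psd: "psd (Q + diag e)"
    using sym by (auto simp: psd_def transpose_def diag_def vec_eq_iff)
  \<comment> \<open>The corner of the box at which \<open>e \<bullet> z\<close> is maximal.\<close>
  define z :: "real^'n" where "z = (\<chi> i. if e $ i < 0 then a $ i else b $ i)"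
  have "(v, z) \<in> cbox (v, a) (v, b)"
    using ab by (simp add: box mem_box_cart z_def)
  from below[OF this] \<open>\<beta> < 0\<close> have "\<tau> * (v + e \<bullet> z) < 0"
    by (simp add: inner_n d_eq distrib_left)
  with \<open>0 < \<tau>\<close> have "v + e \<bullet> z < 0"
    by (simp add: mult_less_0_iff)
  moreover have "e \<bullet> z = (\<Sum>i | e $ i < 0. e $ i * a $ i) + (\<Sum>i | e $ i > 0. e $ i * b $ i)"
  proof -
    have "e \<bullet> z = (\<Sum>i\<in>UNIV. (if e $ i < 0 then e $ i * a $ i else 0)
        + (if e $ i > 0 then e $ i * b $ i else 0))"
      unfolding inner_vec_def by (intro sum.cong) (auto simp: z_def)
    then show ?thesis
      by (simp add: sum.distrib sum.If_cases)
  qed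
  ultimately show ?thesis
    using that[OF psd] by simp
qed

section \<open>The envelopes of the square\<close>

lemma square_le_largest_convex_below:
  assumes "largest_convex_below S l" "x \<in> {lo S..hi S}"
  shows "x\<^sup>2 \<le> l x"
proof -
  have "convex_on {lo S..hi S} (\<lambda>x. x\<^sup>2)"
    by (rule convex_on_subset[OF convex_power2]) auto
  with assms show ?thesis by (auto simp: largest_convex_below_def)
qed

text \<open>Both envelopes are compared with the chord of the square over \<open>{lo S..hi S}\<close>.\<close>
lemma largest_convex_below_le_smallest_concave_above:
  assumes S: "compact S" "S \<noteq> {}"
    and l: "largest_convex_below S l" and u: "smallest_concave_above S u"
    and x: "x \<in> {lo S..hi S}"
  shows "l x \<le> u x"
proof -
  have "x \<in> closed_segment (lo S) (hi S)"
    using x by (simp add: closed_segment_eq_real_ivl)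
  then obtain t where t: "0 \<le> t" "t \<le> 1" and xt: "x = (1 - t) *\<^sub>R lo S + t *\<^sub>R hi S"
    by (auto simp: in_segment)
  have ends: "lo S \<in> S" "hi S \<in> S" "lo S \<le> hi S"
    using lo_compact[OF S] hi_compact[OF S] by auto
  have "l x \<le> (1 - t) * l (lo S) + t * l (hi S)"
    using l t ends unfolding xt largest_convex_below_def
    by (intro convex_onD[where A = "{lo S..hi S}"]) auto
  also have "\<dots> \<le> (1 - t) * u (lo S) + t * u (hi S)"
    using l u t ends unfolding largest_convex_below_def smallest_concave_above_def
    by (intro add_mono mult_left_mono) (meson order_trans, auto intro: order_trans)
  also have "\<dots> \<le> u x"
    using u t ends unfolding xt smallest_concave_above_def
    by (intro concave_onD[where A = "{lo S..hi S}"]) auto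
  finally show ?thesis .
qed

section \<open>Cutting off an optimal solution\<close>

text \<open>
  The witness is \<open>X = Y + x x\<^sup>T\<close>, which is feasible for the relaxation together with \<open>x\<close>.
\<close>
lemma mu_BW_le:
  assumes "psd Y" and "\<And>i. lo (S i) \<le> x $ i \<and> x $ i \<le> hi (S i)"
    and "\<And>i. l i (x $ i) - (x $ i)\<^sup>2 \<le> Y $ i $ i" "\<And>i. Y $ i $ i \<le> u i (x $ i) - (x $ i)\<^sup>2"
  shows "mu_BW Q q S l u \<le> ereal (mat_inner Q Y + x \<bullet> (Q *v x) + q \<bullet> x)"
proof -
  have "transpose (Y + outer x) = Y + outer x"
    using psd_add[OF assms(1) psd_outer[of x]] by (simp add: psd_def)
  then have "(x, Y + outer x) \<in> BW_feasible S l u"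
    using assms psd_bordered[OF assms(1), of x]
    by (simp add: BW_feasible_def outer_diagonal algebra_simps)
  from INF_lower[OF this, of "\<lambda>(x, X). ereal (mat_inner Q X + q \<bullet> x)"] show ?thesis
    by (simp add: mu_BW_def mat_inner_add mat_inner_outer)
qed

theorem theorem2:
  fixes Q :: "real^'n^'n" and q :: "real^'n"
    and S :: "'n \<Rightarrow> real set"
    and l u :: "'n \<Rightarrow> real \<Rightarrow> real"
    and D :: "(real^'n) set"
    and xbar :: "real^'n" and vbar :: real
  assumes "indefinite Q"
    and "\<And>i. S i \<noteq> {}" and "\<And>i. closed (S i)" and "\<And>i. bounded (S i)"
    and "\<And>i. largest_convex_below (S i) (l i)"
    and "\<And>i. smallest_concave_above (S i) (u i)"
    and "D \<subseteq> {d. psd (Q + diag d)}"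
    and "mu_DiagR Q q S l u D < mu_BW Q q S l u"
    and "DiagR_optimal Q q S l u D xbar vbar"
  shows "\<exists>dhat. dhat \<notin> D \<and> psd (Q + diag dhat) \<and>
    vbar < xbar \<bullet> (Q *v xbar)
      + (\<Sum>i | dhat $ i < 0. dhat $ i * ((xbar $ i)\<^sup>2 - l i (xbar $ i)))
      + (\<Sum>i | dhat $ i > 0. dhat $ i * ((xbar $ i)\<^sup>2 - u i (xbar $ i)))"
proof -
  have feasible: "(xbar, vbar) \<in> DiagR_feasible Q S l u D"
    and opt: "\<And>y w. (y, w) \<in> DiagR_feasible Q S l u D \<Longrightarrow> vbar + q \<bullet> xbar \<le> w + q \<bullet> y"
    using assms(9) by (auto simp: DiagR_optimal_def)
  have box: "lo (S i) \<le> xbar $ i \<and> xbar $ i \<le> hi (S i)" for i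
    using feasible by (simp add: DiagR_feasible_def)
  have "ereal (vbar + q \<bullet> xbar) \<le> mu_DiagR Q q S l u D"
    unfolding mu_DiagR_def using opt by (intro INF_greatest) auto
  from this assms(8) have gap: "ereal (vbar + q \<bullet> xbar) < mu_BW Q q S l u"
    by (rule order.strict_trans1)
  define a :: "real^'n" where "a = (\<chi> i. l i (xbar $ i) - (xbar $ i)\<^sup>2)"
  define b :: "real^'n" where "b = (\<chi> i. u i (xbar $ i) - (xbar $ i)\<^sup>2)"
  have "transpose Q = Q"
    using assms(1) by (simp add: indefinite_def)
  moreover have "0 \<le> a $ i" for i
    using square_le_largest_convex_below[OF assms(5)] box by (simp add: a_def)
  moreover have "a $ i \<le> b $ i" for i
    using largest_convex_below_le_smallest_concave_above[OF _ assms(2,5,6)] assms(3,4) box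
    by (simp add: a_def b_def compact_eq_bounded_closed)
  moreover have "vbar - xbar \<bullet> (Q *v xbar) < mat_inner Q Y"
    if "psd Y" "\<And>i. a $ i \<le> Y $ i $ i" "\<And>i. Y $ i $ i \<le> b $ i" for Y
  proof -
    have "mu_BW Q q S l u \<le> ereal (mat_inner Q Y + xbar \<bullet> (Q *v xbar) + q \<bullet> xbar)"
      using that box by (intro mu_BW_le) (auto simp: a_def b_def)
    with gap have "ereal (vbar + q \<bullet> xbar) < ereal (mat_inner Q Y + xbar \<bullet> (Q *v xbar) + q \<bullet> xbar)"
      by (rule order.strict_trans2)
    then show ?thesis by simp
  qed
  ultimately obtain d where d: "psd (Q + diag d)"
    and neg: "vbar - xbar \<bullet> (Q *v xbar)
      + (\<Sum>i | d $ i < 0. d $ i * a $ i) + (\<Sum>i | d $ i > 0. d $ i * b $ i) < 0"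
    using diagonal_sdp_alternative[of Q a b "vbar - xbar \<bullet> (Q *v xbar)"] by blast
  have "(\<Sum>i | d $ i < 0. d $ i * ((xbar $ i)\<^sup>2 - l i (xbar $ i)))
      = - (\<Sum>i | d $ i < 0. d $ i * a $ i)"
    "(\<Sum>i | d $ i > 0. d $ i * ((xbar $ i)\<^sup>2 - u i (xbar $ i)))
      = - (\<Sum>i | d $ i > 0. d $ i * b $ i)"
    by (simp_all add: a_def b_def algebra_simps flip: sum_negf)
  with neg have cut: "vbar < diag_bound Q l u d xbar"
    by (simp add: diag_bound_def)
  then have "d \<notin> D"
    using feasible by (auto simp: DiagR_feasible_def not_le[symmetric])
  with d cut show ?thesis
    unfolding diag_bound_def by blast
qed

end
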